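(* Let $\mathcal{A}$ be an assosymmetric algebra over a field $F$ that is of finite class. Then $\mathcal{A}\circ\mathcal{A}$ is nilpotent of nilpotent index less than or equal to the class of $\mathcal{A}$.
   Context: An algebra over a field $F$ is an $F$-vector space with a bilinear multiplication (not necessarily associative or unital); "ideal" means two-sided ideal. An assosymmetric algebra is an algebra satisfying $(xy)z-x(yz)=(yx)z-y(xz)$ (left symmetry) and $(xy)z-x(yz)=(xz)y-x(zy)$ (right symmetry) for all $x,y,z$. Write $[a,b]=ab-ba$. For subspaces $A,B$ of $\mathcal{A}$, $[A,B]$ is the linear span of all $[a,b]$ with $a\in A$, $b\in B$; $AB$ is the linear span of all $ab$ with $a\in A$, $b\in B$; and $A\circ B$ is the ideal of $\mathcal{A}$ generated by $[A,B]$. Define $H_1=\mathcal{A}$ and $H_{i+1}=H_i\circ\mathcal{A}$ for $i\ge 1$. The algebra $\mathcal{A}$ is of finite class if $H_n=(0)$ for some positive integer $n$; for the minimal such $n$, the class of $\mathcal{A}$ is $n-1$. For a subspace $V$ of $\mathcal{A}$, put $V^1=V$ and $V^n=\sum_{1\le i\le n-1}V^iV^{n-i}$ for $n\ge 2$; $V$ is nilpotent if $V^n=(0)$ for some positive integer $n$, and its nilpotent index is the least such $n$.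
   Formalization: The bound of the nilpotent index by the class is stated only for nonzero algebras: the zero algebra has class 0 while the nilpotent index of its zero ideal is 1, so the bound fails there; nilpotency itself is stated for all algebras of finite class. *)

theory Defs
  imports Complex_Main
begin

text \<open>The algebra is the whole type \<open>'a\<close>; multiplication is an explicit parameter because it is
  neither associative nor unital.\<close>

locale nonassoc_algebra = vector_space scale
  for scale :: "'f::field \<Rightarrow> 'a::ab_group_add \<Rightarrow> 'a" (infixr \<open>*s\<close> 75) +
  fixes mult :: "'a \<Rightarrow> 'a \<Rightarrow> 'a" (infixl \<open>\<cdot>\<close> 70)
  assumes mult_linear_right: "\<And>x. Vector_Spaces.linear scale scale (\<lambda>y. x \<cdot> y)"
    and mult_linear_left: "\<And>y. Vector_Spaces.linear scale scale (\<lambda>x. x \<cdot> y)"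
begin

definition commutator :: "'a \<Rightarrow> 'a \<Rightarrow> 'a"
  where "commutator a b = a \<cdot> b - b \<cdot> a"

definition commutator_space :: "'a set \<Rightarrow> 'a set \<Rightarrow> 'a set"
  where "commutator_space A B = span {commutator a b | a b. a \<in> A \<and> b \<in> B}"

definition product_space :: "'a set \<Rightarrow> 'a set \<Rightarrow> 'a set"
  where "product_space A B = span {a \<cdot> b | a b. a \<in> A \<and> b \<in> B}"

definition two_sided_ideal :: "'a set \<Rightarrow> bool"
  where "two_sided_ideal I \<longleftrightarrow> subspace I \<and> (\<forall>a. \<forall>x\<in>I. a \<cdot> x \<in> I \<and> x \<cdot> a \<in> I)"

definition circ :: "'a set \<Rightarrow> 'a set \<Rightarrow> 'a set"
  where "circ A B = two_sided_ideal hull commutator_space A B"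

text \<open>Indexed from 1, as usual; the value at index 0 is a dummy and is never used.\<close>

fun H :: "nat \<Rightarrow> 'a set"
  where
    "H 0 = UNIV"
  | "H (Suc 0) = UNIV"
  | "H (Suc (Suc i)) = circ (H (Suc i)) UNIV"

definition finite_class :: bool
  where "finite_class \<longleftrightarrow> (\<exists>n\<ge>1. H n = {0})"

text \<open>Meaningful only when \<open>finite_class\<close> holds.\<close>

definition nilpotency_class :: nat
  where "nilpotency_class = (LEAST n. n \<ge> 1 \<and> H n = {0}) - 1"

text \<open>A sum of subspaces is the span of their union. Index 0 is again a dummy.\<close>

fun subspace_power :: "'a set \<Rightarrow> nat \<Rightarrow> 'a set"
  where
    "subspace_power V n =
      (if n \<le> 1 then V
       else span (\<Union>i\<in>{1..n-1}. product_space (subspace_power V i) (subspace_power V (n - i))))"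

declare subspace_power.simps [simp del]

definition nilpotent :: "'a set \<Rightarrow> bool"
  where "nilpotent V \<longleftrightarrow> (\<exists>n\<ge>1. subspace_power V n = {0})"

text \<open>Meaningful only when \<open>nilpotent V\<close> holds. The index is always at least 1, even for
  \<open>V = {0}\<close>, whereas the class of the zero algebra is 0; so a bound of the index by the class
  can hold for nonzero algebras only.\<close>

definition nilpotent_index :: "'a set \<Rightarrow> nat"
  where "nilpotent_index V = (LEAST n. n \<ge> 1 \<and> subspace_power V n = {0})"

end

locale assosymmetric_algebra = nonassoc_algebra scale mult
  for scale :: "'f::field \<Rightarrow> 'a::ab_group_add \<Rightarrow> 'a" (infixr \<open>*s\<close> 75)
    and mult :: "'a \<Rightarrow> 'a \<Rightarrow> 'a" (infixl \<open>\<cdot>\<close> 70) +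
  assumes left_symmetry: "(x \<cdot> y) \<cdot> z - x \<cdot> (y \<cdot> z) = (y \<cdot> x) \<cdot> z - y \<cdot> (x \<cdot> z)"
    and right_symmetry: "(x \<cdot> y) \<cdot> z - x \<cdot> (y \<cdot> z) = (x \<cdot> z) \<cdot> y - x \<cdot> (z \<cdot> y)"

end

theory Submission
  imports Defs
begin

text \<open>
  Write \<open>A\<close> for the algebra, \<open>J = A \<circ> A = H\<^sub>2\<close> and \<open>(x, y, z) = (x \<cdot> y) \<cdot> z - x \<cdot> (y \<cdot> z)\<close>. In an
  assosymmetric algebra \<open>(x, y, z)\<close> is invariant under all permutations of its arguments.
  The series \<open>H\<close> turns out to be a filtration with
  \<open>H\<^sub>m \<cdot> H\<^sub>n \<subseteq> H\<^bsub>m+n-1\<^esub>\<close>. Put \<open>K\<^sub>n = H\<^bsub>n+1\<^esub>\<close>; then \<open>K\<^sub>i \<cdot> K\<^sub>j \<subseteq> K\<^bsub>i+j\<^esub>\<close> and \<open>J = K\<^sub>1\<close>, so that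
  \<open>J\<^sup>n \<subseteq> H\<^bsub>n+1\<^esub>\<close>, and this vanishes when \<open>n\<close> is the class.

  The product rule is the analogue of a theorem of Jennings on Lie nilpotent associative rings.
  There one writes a generator of \<open>H\<^sub>m\<close> as \<open>[x, a]\<close> with \<open>x \<in> H\<^bsub>m-1\<^esub>\<close> and shifts the commutator
  with \<open>a\<close> onto the other factor: \<open>[x, a] \<cdot> y = [x \<cdot> y, a] - x \<cdot> [y, a]\<close>. Here the commutator with
  \<open>a\<close> is a derivation only up to an associator, namely
  \<open>[x \<cdot> y, a] = x \<cdot> [y, a] + [x, a] \<cdot> y + (x, y, a)\<close>, so associators have to be estimated
  as well. The three statements
  \<open>H\<^sub>m \<cdot> H\<^sub>n \<subseteq> H\<^bsub>m+n-1\<^esub>\<close>, \<open>[H\<^sub>m, H\<^sub>n] \<subseteq> H\<^bsub>m+n\<^esub>\<close> and \<open>(H\<^sub>m, A, H\<^sub>n) \<subseteq> H\<^bsub>m+n\<^esub>\<close>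
  are proved together by induction on \<open>m\<close> (lemma \<open>H_filtration\<close>). The induction closes
  thanks to three further facts.

  \<^item> Lemma \<open>circ_minimal\<close>: the ideal generated by \<open>[B, A]\<close>, for an ideal \<open>B\<close>, is already
    \<open>[B, A] + [B, A] \<cdot> A\<close>, so that only elements \<open>[x, a]\<close> and \<open>[x, a] \<cdot> b\<close> need to be considered.

  \<^item> Lemma \<open>jacobi\<close>: the algebra is Lie-admissible.

  \<^item> Lemma \<open>associator_commutator\<close>:
    \<open>([w, x], y, z) = [x, (w, y, z)] - [w, (x, y, z)]\<close>, which gains one step in the series for
    an associator that has a commutator as an argument.
\<close>

section \<open>Ideals and the series of iterated commutator ideals\<close>

context nonassoc_algebra
begin

definition associator :: "'a \<Rightarrow> 'a \<Rightarrow> 'a \<Rightarrow> 'a"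
  where "associator x y z = (x \<cdot> y) \<cdot> z - x \<cdot> (y \<cdot> z)"

lemma mult_add_right: "x \<cdot> (y + z) = x \<cdot> y + x \<cdot> z"
  and mult_scale_right: "x \<cdot> (c *s y) = c *s (x \<cdot> y)"
  and mult_zero_right: "x \<cdot> 0 = 0"
  and mult_neg_right: "x \<cdot> (- y) = - (x \<cdot> y)"
  and mult_diff_right: "x \<cdot> (y - z) = x \<cdot> y - x \<cdot> z"
proof -
  interpret Vector_Spaces.linear scale scale "\<lambda>y. x \<cdot> y" by (rule mult_linear_right)
  show "x \<cdot> (y + z) = x \<cdot> y + x \<cdot> z" "x \<cdot> (c *s y) = c *s (x \<cdot> y)" "x \<cdot> 0 = 0"
    "x \<cdot> (- y) = - (x \<cdot> y)" "x \<cdot> (y - z) = x \<cdot> y - x \<cdot> z"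
    by (rule add scale zero neg diff)+
qed

lemma mult_add_left: "(x + y) \<cdot> z = x \<cdot> z + y \<cdot> z"
  and mult_scale_left: "(c *s x) \<cdot> z = c *s (x \<cdot> z)"
  and mult_zero_left: "0 \<cdot> z = 0"
  and mult_neg_left: "(- x) \<cdot> z = - (x \<cdot> z)"
  and mult_diff_left: "(x - y) \<cdot> z = x \<cdot> z - y \<cdot> z"
proof -
  interpret Vector_Spaces.linear scale scale "\<lambda>x. x \<cdot> z" by (rule mult_linear_left)
  show "(x + y) \<cdot> z = x \<cdot> z + y \<cdot> z" "(c *s x) \<cdot> z = c *s (x \<cdot> z)" "0 \<cdot> z = 0"
    "(- x) \<cdot> z = - (x \<cdot> z)" "(x - y) \<cdot> z = x \<cdot> z - y \<cdot> z"
    by (rule add scale zero neg diff)+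
qed

lemmas mult_bilinear =
  mult_add_right mult_scale_right mult_zero_right mult_neg_right mult_diff_right
  mult_add_left mult_scale_left mult_zero_left mult_neg_left mult_diff_left

lemma commutator_flip: "commutator x y = - commutator y x"
  by (simp add: commutator_def)

lemma subspace_mult_left_preimage: "subspace S \<Longrightarrow> subspace {z. z \<cdot> y \<in> S}"
  by (auto intro!: subspaceI simp: mult_bilinear subspace_0 subspace_add subspace_scale)

lemma subspace_commutator_preimage: "subspace S \<Longrightarrow> subspace {z. commutator z y \<in> S}"
proof (rule subspaceI)
  assume S: "subspace S"
  show "0 \<in> {z. commutator z y \<in> S}"
    using S by (simp add: commutator_def mult_bilinear subspace_0)
  show "x + x' \<in> {z. commutator z y \<in> S}"
    if "x \<in> {z. commutator z y \<in> S}" "x' \<in> {z. commutator z y \<in> S}" for x x'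
  proof -
    have "commutator (x + x') y = commutator x y + commutator x' y"
      by (simp add: commutator_def mult_bilinear)
    then show ?thesis using that S by (simp add: subspace_add)
  qed
  show "c *s x \<in> {z. commutator z y \<in> S}" if "x \<in> {z. commutator z y \<in> S}" for c x
  proof -
    have "commutator (c *s x) y = c *s commutator x y"
      by (simp add: commutator_def mult_bilinear scale_right_diff_distrib)
    then show ?thesis using that S by (simp add: subspace_scale)
  qed
qed

lemma ideal_subspace: "two_sided_ideal I \<Longrightarrow> subspace I"
  and ideal_mult_right: "two_sided_ideal I \<Longrightarrow> x \<in> I \<Longrightarrow> x \<cdot> a \<in> I"
  and ideal_mult_left: "two_sided_ideal I \<Longrightarrow> x \<in> I \<Longrightarrow> a \<cdot> x \<in> I"
  by (auto simp: two_sided_ideal_def)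

lemma ideal_commutator:
  assumes "two_sided_ideal I" "x \<in> I"
  shows "commutator x a \<in> I" "commutator a x \<in> I"
  using assms
  by (simp_all add: commutator_def subspace_diff ideal_subspace ideal_mult_right ideal_mult_left)

lemma ideal_Inter: "(\<And>I. I \<in> X \<Longrightarrow> two_sided_ideal I) \<Longrightarrow> two_sided_ideal (\<Inter>X)"
  unfolding two_sided_ideal_def by (auto intro!: subspace_Inter)

lemma ideal_circ: "two_sided_ideal (circ A B)"
  unfolding circ_def by (rule hull_in) (auto intro: ideal_Inter)

lemma commutator_in_circ: "a \<in> A \<Longrightarrow> b \<in> B \<Longrightarrow> commutator a b \<in> circ A B"
  unfolding circ_def commutator_space_def
  by (rule subsetD[OF hull_subset]) (auto intro: span_base)

lemma ideal_UNIV: "two_sided_ideal UNIV"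
  by (simp add: two_sided_ideal_def)

lemma ideal_H: "two_sided_ideal (H n)"
  by (cases n rule: H.cases) (auto simp: ideal_UNIV ideal_circ)

lemma H_Suc: "n \<ge> 1 \<Longrightarrow> H (Suc n) = circ (H n) UNIV"
  by (cases n) auto

lemma commutator_H_right: "n \<ge> 1 \<Longrightarrow> x \<in> H n \<Longrightarrow> commutator x a \<in> H (Suc n)"
  by (simp add: H_Suc commutator_in_circ)

lemma commutator_H_left: "n \<ge> 1 \<Longrightarrow> x \<in> H n \<Longrightarrow> commutator a x \<in> H (Suc n)"
  using commutator_H_right[of n x a] commutator_flip[of a x]
  by (simp add: subspace_neg ideal_subspace ideal_H)

section \<open>The associator\<close>

text \<open>The Teichmueller identity, valid in every nonassociative algebra.\<close>

lemma teichmueller: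
  "associator (w \<cdot> x) y z - associator w (x \<cdot> y) z + associator w x (y \<cdot> z)
    = w \<cdot> associator x y z + associator w x y \<cdot> z"
  by (simp add: associator_def mult_bilinear)

end

context assosymmetric_algebra
begin

lemma associator_swap12: "associator x y z = associator y x z"
  and associator_swap23: "associator x y z = associator x z y"
  using left_symmetry right_symmetry by (simp_all add: associator_def)

lemmas associator_perm = associator_swap12 associator_swap23

text \<open>In every algebra the defect of this product rule is \<open>(x, y, z) - (x, z, y) + (z, x, y)\<close>;
  symmetry reduces it to a single associator.\<close>

lemma commutator_mult:
  "commutator (x \<cdot> y) z = x \<cdot> commutator y z + commutator x z \<cdot> y + associator x y z"
proof -
  have "commutator (x \<cdot> y) z = x \<cdot> commutator y z + commutator x z \<cdot> y
      + (associator x y z - associator x z y + associator z x y)"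
    by (simp add: commutator_def associator_def mult_bilinear algebra_simps)
  then show ?thesis
    by (simp add: associator_swap12[of z x y])
qed

text \<open>The Jacobi sum is an alternating sum of associators, which cancels by symmetry.\<close>

lemma jacobi:
  "commutator (commutator x a) y = commutator (commutator x y) a + commutator x (commutator a y)"
proof -
  have "commutator (commutator x a) y
      = commutator (commutator x y) a + commutator x (commutator a y)
        + ((associator x a y - associator a x y) + (associator a y x - associator y a x)
          + (associator y x a - associator x y a))"
    by (simp add: commutator_def associator_def mult_bilinear algebra_simps)
  then show ?thesis
    by (simp add: associator_perm)
qed

text \<open>Let \<open>w, x, y, z\<close> be fixed. The terms of the Teichmueller identity are then values
  \<open>(p \<cdot> q, r, s)\<close> for ordered pairs \<open>(p, q)\<close> of distinct variables. Adding the identity to its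
  cyclic shift cancels the values at \<open>(x, y)\<close> and \<open>(y, z)\<close> and leaves two of them.\<close>

lemma associator_product_pair:
  "associator (w \<cdot> x) y z + associator (z \<cdot> w) x y
    = (w \<cdot> associator x y z + associator w x y \<cdot> z)
      + (x \<cdot> associator w y z + associator x y z \<cdot> w)"
proof -
  have eqs: "associator w (x \<cdot> y) z = associator (x \<cdot> y) z w"
    "associator w x (y \<cdot> z) = associator x (y \<cdot> z) w"
    "associator x y (z \<cdot> w) = associator (z \<cdot> w) x y"
    by (simp_all add: associator_perm)
  have "associator (w \<cdot> x) y z + associator (z \<cdot> w) x y
    = (associator (w \<cdot> x) y z - associator w (x \<cdot> y) z + associator w x (y \<cdot> z))
      + (associator (x \<cdot> y) z w - associator x (y \<cdot> z) w + associator x y (z \<cdot> w))"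
    unfolding eqs by (simp add: algebra_simps)
  also have "\<dots> = (w \<cdot> associator x y z + associator w x y \<cdot> z)
      + (x \<cdot> associator y z w + associator x y z \<cdot> w)"
    by (simp only: teichmueller)
  also have "associator y z w = associator w y z"
    by (simp add: associator_perm)
  finally show ?thesis .
qed

text \<open>The left side is \<open>(w \<cdot> x, y, z) - (x \<cdot> w, y, z)\<close>. Comparing two instances of
  \<open>associator_product_pair\<close> shows how \<open>(p \<cdot> q, r, s)\<close> changes when \<open>p\<close> or \<open>q\<close> is exchanged for
  another variable. One passes from \<open>w \<cdot> x\<close> to \<open>x \<cdot> w\<close> by three such exchanges, through
  \<open>y \<cdot> x\<close> and \<open>y \<cdot> w\<close>.\<close>

lemma associator_commutator:
  "associator (commutator w x) y z
    = commutator x (associator w y z) - commutator w (associator x y z)"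
proof -
  have exch_left: "associator (p \<cdot> q) r s - associator (s \<cdot> q) r p
      = associator q r s \<cdot> p - associator q r p \<cdot> s" for p q r s
  proof -
    have "associator (p \<cdot> q) r s - associator (s \<cdot> q) r p
        = (associator (q \<cdot> r) s p + associator (p \<cdot> q) r s)
          - (associator (q \<cdot> r) p s + associator (s \<cdot> q) r p)"
      by (simp add: associator_swap23[of "q \<cdot> r" s p])
    also have "\<dots> = associator q r s \<cdot> p - associator q r p \<cdot> s"
      unfolding associator_product_pair
      by (simp add: associator_swap23[of r s p] associator_swap23[of q s p])
    finally show ?thesis .
  qed
  have exch_right: "associator (q \<cdot> p) r s - associator (q \<cdot> r) p s
      = p \<cdot> associator q r s - r \<cdot> associator q p s" for p q r s
  proof -
    have "associator (q \<cdot> p) r s - associator (q \<cdot> r) p s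
        = (associator (q \<cdot> p) r s + associator (s \<cdot> q) p r)
          - (associator (q \<cdot> r) p s + associator (s \<cdot> q) r p)"
      by (simp add: associator_swap23[of "s \<cdot> q" p r])
    also have "\<dots> = p \<cdot> associator q r s - r \<cdot> associator q p s"
      unfolding associator_product_pair
      by (simp add: associator_swap23[of q p r] associator_swap12[of p r s])
    finally show ?thesis .
  qed
  have "associator (commutator w x) y z = associator (w \<cdot> x) y z - associator (x \<cdot> w) y z"
    by (simp add: associator_def commutator_def mult_bilinear)
  also have "\<dots> = (associator (w \<cdot> x) z y - associator (y \<cdot> x) z w)
      + (associator (y \<cdot> x) w z - associator (y \<cdot> w) x z)
      + (associator (y \<cdot> w) z x - associator (x \<cdot> w) z y)"
    by (simp add: associator_swap23[of _ z] algebra_simps)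
  also have "\<dots> = commutator x (associator w y z) - commutator w (associator x y z)"
    unfolding exch_left exch_right
    by (simp add: associator_perm commutator_def)
  finally show ?thesis .
qed

text \<open>The span of the elements \<open>[x, a]\<close> and \<open>[x, a] \<cdot> b\<close> with \<open>x \<in> B\<close> is an ideal, and hence all
  of \<open>B \<circ> A\<close>. It is stable under left multiplication once it is stable under right
  multiplication, because it lies in \<open>B\<close> and contains \<open>[B, A]\<close>. For right multiplication,
  \<open>([x, a] \<cdot> b) \<cdot> c\<close> differs from \<open>[x, a] \<cdot> (b \<cdot> c)\<close> by an associator with an argument in \<open>B\<close>, which
  \<open>commutator_mult\<close> expresses through commutators.\<close>

lemma circ_minimal:
  assumes B: "two_sided_ideal B" and T: "subspace T"
    and comm: "\<And>x a. x \<in> B \<Longrightarrow> commutator x a \<in> T"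
    and comm_mult: "\<And>x a b. x \<in> B \<Longrightarrow> commutator x a \<cdot> b \<in> T"
  shows "circ B UNIV \<subseteq> T"
proof -
  define gens where
    "gens = {commutator x a | x a. x \<in> B} \<union> {commutator x a \<cdot> b | x a b. x \<in> B}"
  let ?G = "span gens"
  have g1: "commutator x a \<in> ?G" and g2: "commutator x a \<cdot> b \<in> ?G" if "x \<in> B" for x a b
    using that by (force simp: gens_def intro!: span_base)+
  have GB: "?G \<subseteq> B"
    using B by (intro span_minimal ideal_subspace)
      (force simp: gens_def ideal_commutator ideal_mult_right)
  have assoc_G: "associator u b c \<in> ?G" if u: "u \<in> B" for u b c
  proof -
    have "associator u b c = associator b c u"
      by (simp add: associator_perm)
    also have "\<dots> = commutator u b \<cdot> c + (commutator u c \<cdot> b - commutator (commutator u c) b)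
        - commutator u (b \<cdot> c)"
      using commutator_mult[of b c u] by (simp add: commutator_def mult_bilinear algebra_simps)
    finally show ?thesis
      using g1 g2 u ideal_commutator[OF B] by (simp add: span_add span_diff)
  qed
  have right: "g \<cdot> c \<in> ?G" if "g \<in> ?G" for g c
  proof -
    have "?G \<subseteq> {g. g \<cdot> c \<in> ?G}"
    proof (intro span_minimal subspace_mult_left_preimage subspace_span subsetI)
      fix g assume "g \<in> gens"
      then consider x a where "x \<in> B" "g = commutator x a"
        | x a b where "x \<in> B" "g = commutator x a \<cdot> b"
        by (auto simp: gens_def)
      then show "g \<in> {g. g \<cdot> c \<in> ?G}"
      proof cases
        case 1
        then show ?thesis using g2 by simp
      next
        case 2
        have "(commutator x a \<cdot> b) \<cdot> c = commutator x a \<cdot> (b \<cdot> c) + associator (commutator x a) b c"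
          by (simp add: associator_def)
        then show ?thesis
          using 2 g2 assoc_G ideal_commutator[OF B] by (simp add: span_add)
      qed
    qed
    then show ?thesis using that by auto
  qed
  have left: "c \<cdot> g \<in> ?G" if "g \<in> ?G" for g c
  proof -
    have "c \<cdot> g = g \<cdot> c - commutator g c"
      by (simp add: commutator_def)
    then show ?thesis using right g1 that GB by (auto intro!: span_diff)
  qed
  have "two_sided_ideal ?G"
    using left right by (simp add: two_sided_ideal_def subspace_span)
  moreover have "commutator_space B UNIV \<subseteq> ?G"
    unfolding commutator_space_def by (rule span_minimal) (auto simp: subspace_span g1)
  ultimately have "circ B UNIV \<subseteq> ?G"
    unfolding circ_def by (intro hull_minimal)
  also have "?G \<subseteq> T"
    using comm comm_mult by (intro span_minimal T) (auto simp: gens_def)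
  finally show ?thesis .
qed

section \<open>The multiplicative filtration\<close>

text \<open>The position of \<open>y\<close> in \<open>commutator_mult\<close> matters: with \<open>y\<close> in the last place every
  other term is a commutator with \<open>y\<close>, times at most one factor.\<close>

lemma associator_H:
  assumes "n \<ge> 1" "y \<in> H n"
  shows "associator a b y \<in> H (Suc n)"
proof -
  have "associator a b y = commutator (a \<cdot> b) y - a \<cdot> commutator b y - commutator a y \<cdot> b"
    by (simp add: commutator_mult)
  then show ?thesis
    using assms commutator_H_left[of n y] ideal_H
    by (simp add: subspace_diff ideal_subspace ideal_mult_left ideal_mult_right)
qed

text \<open>The three claims are joined because each one feeds the others in the step from \<open>m\<close> to
  \<open>m + 1\<close>: products use all associators and products at \<open>m\<close>, commutators use the new
  products, the old commutators by way of \<open>jacobi\<close>, and associators of commutators; the new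
  associators come from the new products and commutators by \<open>commutator_mult\<close>. The index \<open>n\<close>
  varies, since the commutator with \<open>a\<close> is moved from the first factor to the second.\<close>

lemma H_filtration:
  assumes "m \<ge> 1" "n \<ge> 1" "x \<in> H m" "y \<in> H n"
  shows "x \<cdot> y \<in> H (m + n - 1) \<and> commutator x y \<in> H (m + n) \<and> associator x a y \<in> H (m + n)"
  using assms
proof (induction m arbitrary: n x y a rule: nat_induct_at_least)
  case base
  then show ?case
    by (simp add: ideal_mult_left ideal_H commutator_H_left associator_H)
next
  case (Suc m)
  note IH = Suc.IH
  have sub: "subspace (H k)" for k
    by (simp add: ideal_subspace ideal_H)
  have m: "m \<ge> 1" by fact
  have IHmult: "x \<cdot> y \<in> H (m + k - 1)" and IHcomm: "commutator x y \<in> H (m + k)"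
    and IHassoc: "associator x a y \<in> H (m + k)"
    if "k \<ge> 1" "x \<in> H m" "y \<in> H k" for k x y a
    using IH that by blast+
  have gen_mult: "commutator x a \<cdot> y \<in> H (m + k)" if k: "k \<ge> 1" "x \<in> H m" "y \<in> H k" for k x y a
  proof -
    have "commutator (x \<cdot> y) a \<in> H (m + k)"
      using commutator_H_right[of "m + k - 1" "x \<cdot> y" a] IHmult[OF k] k m by simp
    moreover have "x \<cdot> commutator y a \<in> H (m + k)"
      using IHmult[of "Suc k" x "commutator y a"] commutator_H_right k by simp
    moreover have "associator x y a \<in> H (m + k)"
      using IHassoc[OF k, of a] by (simp add: associator_swap23[of x a y])
    moreover have "commutator x a \<cdot> y = commutator (x \<cdot> y) a - x \<cdot> commutator y a - associator x y a"
      by (simp add: commutator_mult)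
    ultimately show ?thesis by (simp add: subspace_diff sub)
  qed
  have mult: "x \<cdot> y \<in> H (m + k)" if x: "x \<in> H (Suc m)" and k: "k \<ge> 1" "y \<in> H k" for k x y
  proof -
    have "circ (H m) UNIV \<subseteq> {x. x \<cdot> y \<in> H (m + k)}"
    proof (intro circ_minimal subspace_mult_left_preimage ideal_H sub CollectI)
      fix x a b assume x: "x \<in> H m"
      let ?u = "commutator x a"
      show "?u \<cdot> y \<in> H (m + k)"
        using gen_mult x k by simp
      \<comment> \<open>Moving \<open>b\<close> past \<open>y\<close> by right symmetry leaves only products of \<open>[x, a]\<close> with
        elements of \<open>H k\<close>, which are known.\<close>
      have "(?u \<cdot> b) \<cdot> y = ?u \<cdot> (b \<cdot> y) + ((?u \<cdot> y) \<cdot> b - ?u \<cdot> (y \<cdot> b))"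
        using associator_swap23[of ?u b y] by (simp add: associator_def algebra_simps)
      then show "(?u \<cdot> b) \<cdot> y \<in> H (m + k)"
        using gen_mult[of k x] x k
        by (simp add: subspace_add subspace_diff sub ideal_mult_left ideal_mult_right ideal_H)
    qed
    then show ?thesis using x m by (auto simp: H_Suc)
  qed
  have gen_comm: "commutator (commutator x a) y \<in> H (Suc (m + k))"
    if k: "k \<ge> 1" "x \<in> H m" "y \<in> H k" for k x y a
  proof -
    have "commutator (commutator x y) a \<in> H (Suc (m + k))"
      using commutator_H_right IHcomm k by simp
    moreover have "commutator x (commutator a y) \<in> H (Suc (m + k))"
      using IHcomm[of "Suc k" x "commutator a y"] commutator_H_left k by simp
    ultimately show ?thesis
      by (simp add: jacobi[of x a y] subspace_add sub)
  qed
  have gen_assoc: "associator (commutator x a) b y \<in> H (Suc (m + k))"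
    if k: "k \<ge> 1" "x \<in> H m" "y \<in> H k" for k x y a b
  proof -
    have "commutator a (associator x b y) \<in> H (Suc (m + k))"
      using commutator_H_left IHassoc k by simp
    moreover have "commutator x (associator a b y) \<in> H (Suc (m + k))"
      using IHcomm[of "Suc k" x "associator a b y"] associator_H k by simp
    ultimately show ?thesis
      by (simp add: associator_commutator subspace_diff sub)
  qed
  have comm: "commutator x y \<in> H (Suc (m + k))"
    if x: "x \<in> H (Suc m)" and k: "k \<ge> 1" "y \<in> H k" for k x y
  proof -
    have "circ (H m) UNIV \<subseteq> {x. commutator x y \<in> H (Suc (m + k))}"
    proof (intro circ_minimal subspace_commutator_preimage ideal_H sub CollectI)
      fix x a b assume x: "x \<in> H m"
      let ?u = "commutator x a"
      show "commutator ?u y \<in> H (Suc (m + k))"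
        using gen_comm x k by simp
      moreover have "?u \<cdot> commutator b y \<in> H (Suc (m + k))"
        using gen_mult[of "Suc k" x "commutator b y"] commutator_H_left x k by simp
      ultimately show "commutator (?u \<cdot> b) y \<in> H (Suc (m + k))"
        using gen_assoc x k
        by (simp add: commutator_mult subspace_add sub ideal_mult_right ideal_H)
    qed
    then show ?thesis using x m by (auto simp: H_Suc)
  qed
  have "associator x a y = commutator (x \<cdot> a) y - x \<cdot> commutator a y - commutator x y \<cdot> a"
    by (simp add: commutator_mult)
  moreover have "x \<cdot> commutator a y \<in> H (Suc (m + n))"
    using mult[of x "Suc n" "commutator a y"] commutator_H_left Suc.prems by simp
  ultimately have "associator x a y \<in> H (Suc (m + n))"
    using comm[of _ n y] Suc.prems by (simp add: subspace_diff sub ideal_mult_right ideal_H)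
  then show ?case
    using mult comm Suc.prems by simp
qed

end

section \<open>Nilpotency\<close>

context nonassoc_algebra
begin

lemma subspace_subspace_power: "subspace V \<Longrightarrow> subspace (subspace_power V n)"
  by (subst subspace_power.simps) (simp add: subspace_span)

lemma subspace_power_subset_filtration:
  assumes sub: "\<And>n. subspace (K n)"
    and V: "V \<subseteq> K 1"
    and prod: "\<And>i j x y. i \<ge> 1 \<Longrightarrow> j \<ge> 1 \<Longrightarrow> x \<in> K i \<Longrightarrow> y \<in> K j \<Longrightarrow> x \<cdot> y \<in> K (i + j)"
    and "n \<ge> 1"
  shows "subspace_power V n \<subseteq> K n"
  using \<open>n \<ge> 1\<close>
proof (induction n rule: less_induct)
  case (less n)
  show ?case
  proof (cases "n = 1")
    case True
    then show ?thesis using V by (simp add: subspace_power.simps)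
  next
    case False
    have "product_space (subspace_power V i) (subspace_power V (n - i)) \<subseteq> K n"
      if i: "i \<in> {1..n-1}" for i
    proof -
      have "subspace_power V i \<subseteq> K i" "subspace_power V (n - i) \<subseteq> K (n - i)"
        by (rule less.IH; use i False in force)+
      moreover have "i + (n - i) = n" "i \<ge> 1" "n - i \<ge> 1"
        using i False by auto
      ultimately show ?thesis
        unfolding product_space_def using prod[of i "n - i"]
        by (intro span_minimal sub) auto
    qed
    then have "span (\<Union>i\<in>{1..n-1}. product_space (subspace_power V i) (subspace_power V (n - i)))
        \<subseteq> K n"
      by (intro span_minimal sub UN_least)
    then show ?thesis
      using False less.prems by (subst subspace_power.simps) simp
  qed
qed

end

context assosymmetric_algebra
begin

lemma subspace_power_circ_subset_H:
  assumes "n \<ge> 1"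
  shows "subspace_power (circ UNIV UNIV) n \<subseteq> H (Suc n)"
proof (rule subspace_power_subset_filtration[where K = "\<lambda>n. H (Suc n)"])
  show "x \<cdot> y \<in> H (Suc (i + j))" if "x \<in> H (Suc i)" "y \<in> H (Suc j)" for i j x y
    using H_filtration[of "Suc i" "Suc j" x y] that by simp
  show "circ UNIV UNIV \<subseteq> H (Suc 1)" by simp
qed (use assms in \<open>auto simp: ideal_subspace ideal_H\<close>)

text \<open>A nonzero algebra has class at least 1, so the power whose exponent is the class is a genuine
  one.\<close>

lemma subspace_power_circ_class:
  assumes "finite_class" "(UNIV :: 'a set) \<noteq> {0}"
  shows "nilpotency_class \<ge> 1" "subspace_power (circ UNIV UNIV) nilpotency_class = {0}"
proof -
  define N where "N = (LEAST n. n \<ge> 1 \<and> H n = {0})"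
  have N: "N \<ge> 1 \<and> H N = {0}"
    unfolding N_def by (rule LeastI_ex) (use assms(1) in \<open>simp add: finite_class_def\<close>)
  moreover have "N \<noteq> 1"
  proof
    assume "N = 1"
    then have "H (Suc 0) = {0}" using N by simp
    then show False using assms(2) H.simps(2) by blast
  qed
  moreover have c: "nilpotency_class = N - 1"
    by (simp add: nilpotency_class_def N_def)
  ultimately show c1: "nilpotency_class \<ge> 1"
    by linarith
  have "subspace_power (circ UNIV UNIV) nilpotency_class \<subseteq> {0}"
  proof -
    have "Suc nilpotency_class = N" using N c by simp
    then show ?thesis using subspace_power_circ_subset_H[OF c1] N by blast
  qed
  moreover have "0 \<in> subspace_power (circ UNIV UNIV) nilpotency_class"
    by (intro subspace_0 subspace_subspace_power ideal_subspace ideal_circ)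
  ultimately show "subspace_power (circ UNIV UNIV) nilpotency_class = {0}"
    by auto
qed

lemma circ_nilpotent_index_le_class:
  assumes "finite_class"
  shows "nilpotent (circ UNIV UNIV) \<and>
    ((UNIV :: 'a set) \<noteq> {0} \<longrightarrow> nilpotent_index (circ UNIV UNIV) \<le> nilpotency_class)"
proof (cases "(UNIV :: 'a set) = {0}")
  case True
  have "circ UNIV UNIV = {0}"
    using True subspace_0[OF ideal_subspace[OF ideal_circ]] by blast
  then have "nilpotent (circ UNIV UNIV)"
    by (auto simp: nilpotent_def subspace_power.simps intro: exI[of _ 1])
  then show ?thesis
    using True by simp
next
  case False
  note * = subspace_power_circ_class[OF assms False]
  show ?thesis
    using * unfolding nilpotent_def nilpotent_index_def
    by (auto intro!: Least_le)
qed

end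

theorem theorem4p5:
  fixes scale :: "'f::field \<Rightarrow> 'a::ab_group_add \<Rightarrow> 'a"
    and mult :: "'a \<Rightarrow> 'a \<Rightarrow> 'a"
  assumes "assosymmetric_algebra scale mult"
    and "nonassoc_algebra.finite_class scale mult"
  shows "nonassoc_algebra.nilpotent scale mult (nonassoc_algebra.circ scale mult UNIV UNIV) \<and>
    ((UNIV :: 'a set) \<noteq> {0} \<longrightarrow>
      nonassoc_algebra.nilpotent_index scale mult (nonassoc_algebra.circ scale mult UNIV UNIV)
        \<le> nonassoc_algebra.nilpotency_class scale mult)"
  using assosymmetric_algebra.circ_nilpotent_index_le_class[OF assms] .

end
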